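(* Let $p$ be a prime, let $n$ be even, and let $f:\mathbb{F}_{p^n}\to\mathbb{F}_p$. Suppose there exists an $n/2$-dimensional $\mathbb{F}_p$-vector subspace $V$ of $\mathbb{F}_{p^n}$ such that: (i) its orthogonal $V^{\perp}=\{y\in\mathbb{F}_{p^n}:\operatorname{Tr}_n(yv)=0\ \text{for all } v\in V\}$ is supplementary to $V$, i.e. $V\oplus V^{\perp}=\mathbb{F}_{p^n}$; (ii) the second-order derivatives $D_{c,d}f(x)=f(x+c+d)-f(x+c)-f(x+d)+f(x)$ vanish identically on $\mathbb{F}_{p^n}$ for all $c,d\in V$; (iii) for every $c\in V\setminus\{0\}$ the first-order derivative $D_cf(x)=f(x+c)-f(x)$ is balanced on $\mathbb{F}_{p^n}$. Then $f$ is a regular bent function that belongs to the completed Maiorana–McFarland class.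
   Context: $\operatorname{Tr}_n(x)=\sum_{i=0}^{n-1}x^{p^i}$ is the absolute trace $\mathbb{F}_{p^n}\to\mathbb{F}_p$. A function $h:\mathbb{F}_{p^n}\to\mathbb{F}_p$ is balanced if it takes each value of $\mathbb{F}_p$ exactly $p^{n-1}$ times. With $\omega=e^{2\pi i/p}$, the Walsh transform is $S_f(b)=\sum_{x\in\mathbb{F}_{p^n}}\omega^{f(x)-\operatorname{Tr}_n(bx)}$; $f$ is bent if $|S_f(b)|^2=p^n$ for all $b$, and regular bent if for every $b$, $p^{-n/2}S_f(b)=\omega^{f^*(b)}$ for some $f^*(b)\in\mathbb{F}_p$. Functions $f,g:\mathbb{F}_p^n\to\mathbb{F}_p$ are EA-equivalent if $g(x)=a\,f(L(x))+l(x)$ for an affine permutation $L$ of $\mathbb{F}_p^n$, an affine function $l:\mathbb{F}_p^n\to\mathbb{F}_p$ and $a\in\mathbb{F}_p^*$. A class of functions is complete if it is a union of EA-equivalence classes; the completed class of a class is the smallest complete class containing it. The Maiorana–McFarland class consists of the functions $\mathbb{F}_p^m\times\mathbb{F}_p^m\to\mathbb{F}_p$ of the form $f(x,y)=x\cdot\pi(y)+g(y)$ with $\pi$ a permutation of $\mathbb{F}_p^m$ and $g:\mathbb{F}_p^m\to\mathbb{F}_p$ arbitrary (dot = standard inner product); functions on $\mathbb{F}_{p^n}$, $n=2m$, are regarded as functions on $\mathbb{F}_p^m\times\mathbb{F}_p^m$ via an $\mathbb{F}_p$-linear isomorphism. *)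

theory Defs
  imports
    "HOL-Analysis.Analysis"
    "Berlekamp_Zassenhaus.Finite_Field"
begin

text \<open>
  The prime field with \<open>p\<close> elements is \<open>'p mod_ring\<close>, where \<open>p = CARD('p)\<close> is prime by the class
  \<open>prime_card\<close>. The field with \<open>p ^ n\<close> elements is any finite field type \<open>'a\<close> with
  \<open>CARD('a) = CARD('p) ^ n\<close>; the prime field is embedded in it by \<open>fp_embed\<close>. When
  \<open>CHAR('a) = CARD('p)\<close>, \<open>fp_embed\<close> is an injective ring homomorphism and \<open>fp_scale\<close> the
  resulting vector space structure on \<open>'a\<close>.
\<close>

definition fp_embed :: "'p::prime_card mod_ring \<Rightarrow> 'a::field" where
  "fp_embed c = of_int (to_int_mod_ring c)"

definition fp_scale :: "'p::prime_card mod_ring \<Rightarrow> 'a::field \<Rightarrow> 'a" where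
  "fp_scale c x = fp_embed c * x"

lemma CHAR_eq_of_CARD:
  assumes "CARD('a::finite_field) = CARD('p::prime_card) ^ n"
  shows "CHAR('a) = CARD('p)"
proof -
  have "prime CHAR('a)"
    by (intro prime_CHAR_semidom finite_imp_CHAR_pos) auto
  moreover have "CHAR('a) dvd CARD('p) ^ n"
    using CHAR_dvd_CARD[where 'a = 'a] assms by simp
  ultimately show ?thesis
    using prime_card[where 'a = 'p] by (metis prime_dvd_power primes_dvd_imp_eq)
qed

lemma fp_embed_of_int:
  assumes "CHAR('a::field) = CARD('p::prime_card)"
  shows "fp_embed (of_int k :: 'p mod_ring) = (of_int k :: 'a)"
proof -
  have "to_int_mod_ring (of_int k :: 'p mod_ring) = k mod int CARD('p)"
    by transfer simp
  moreover have "(of_int (k mod int CARD('p)) :: 'a) = of_int k"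
    using assms by (simp add: of_int_eq_iff_cong_CHAR cong_def)
  ultimately show ?thesis
    by (simp add: fp_embed_def)
qed

lemma fp_embed_hom:
  fixes x y :: "'p::prime_card mod_ring"
  assumes "CHAR('a::field) = CARD('p)"
  shows "(fp_embed (x + y) :: 'a) = fp_embed x + fp_embed y"
    and "(fp_embed (x * y) :: 'a) = fp_embed x * fp_embed y"
    and "(fp_embed (1 :: 'p mod_ring) :: 'a) = 1"
    and "inj (fp_embed :: 'p mod_ring \<Rightarrow> 'a)"
proof -
  note e = fp_embed_of_int[OF assms]
  have r: "of_int (to_int_mod_ring z) = z" for z :: "'p mod_ring"
    by (simp add: of_int_of_int_mod_ring)
  show "(fp_embed (x + y) :: 'a) = fp_embed x + fp_embed y"
    using e[of "to_int_mod_ring x + to_int_mod_ring y"] by (simp add: r fp_embed_def)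
  show "(fp_embed (x * y) :: 'a) = fp_embed x * fp_embed y"
    using e[of "to_int_mod_ring x * to_int_mod_ring y"] by (simp add: r fp_embed_def)
  show "(fp_embed (1 :: 'p mod_ring) :: 'a) = 1"
    using e[of 1] by simp
  show "inj (fp_embed :: 'p mod_ring \<Rightarrow> 'a)"
  proof (rule injI)
    fix u v :: "'p mod_ring"
    assume "fp_embed u = (fp_embed v :: 'a)"
    then have "[to_int_mod_ring u = to_int_mod_ring v] (mod int CARD('p))"
      using assms by (simp add: fp_embed_def of_int_eq_iff_cong_CHAR)
    then have "(of_int (to_int_mod_ring u) :: 'p mod_ring) = of_int (to_int_mod_ring v)"
      by (simp add: of_int_eq_iff_cong_CHAR)
    then show "u = v" by (simp only: r)
  qed
qed

lemma vector_space_fp_scale: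
  assumes "CHAR('a::field) = CARD('p::prime_card)"
  shows "vector_space (fp_scale :: 'p mod_ring \<Rightarrow> 'a \<Rightarrow> 'a)"
  by unfold_locales
    (simp_all add: fp_scale_def fp_embed_hom [OF assms] ring_distribs mult.assoc)

text \<open>
  The sum lies in the image of the prime field; \<open>abs_trace\<close> is its preimage there (see
  \<open>fp_embed_abs_trace\<close> below).
\<close>

definition abs_trace :: "nat \<Rightarrow> 'a::field \<Rightarrow> 'p::prime_card mod_ring" where
  "abs_trace n x = (THE t. fp_embed t = (\<Sum>i<n. x ^ (CARD('p) ^ i)))"

lemma range_fp_embed:
  assumes "CHAR('a::finite_field) = CARD('p::prime_card)"
  shows "range (fp_embed :: 'p mod_ring \<Rightarrow> 'a) = {x. x ^ CARD('p) = x}"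
proof (rule card_subset_eq)
  let ?p = "CARD('p)"
  note hom = fp_embed_hom[OF assms]
  have p: "?p > 1" using prime_card[where 'a = 'p] prime_gt_1_nat by simp
  have pow: "(fp_embed (c ^ k) :: 'a) = fp_embed c ^ k" for c :: "'p mod_ring" and k
    by (induction k) (simp_all add: hom)
  have "c ^ ?p = c" for c :: "'p mod_ring"
    using finite_field_power_card_eq_same[of c] by simp
  then show sub: "range (fp_embed :: 'p mod_ring \<Rightarrow> 'a) \<subseteq> {x. x ^ ?p = x}"
    by (auto simp flip: pow)
  let ?q = "Polynomial.monom 1 ?p - Polynomial.monom 1 1 :: 'a poly"
  have "Polynomial.coeff ?q ?p = 1" using p by simp
  then have nz: "?q \<noteq> 0" by (metis Polynomial.coeff_0 zero_neq_one)
  have "Polynomial.degree ?q \<le> ?p"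
    using p by (intro degree_diff_le order.trans[OF degree_monom_le]) auto
  moreover have "{x. poly ?q x = 0} = {x. x ^ ?p = x}"
    by (simp add: poly_monom)
  ultimately have "card {x::'a. x ^ ?p = x} \<le> ?p"
    using card_poly_roots_bound[OF nz] by simp
  moreover have "card (range (fp_embed :: 'p mod_ring \<Rightarrow> 'a)) = ?p"
    using hom(4) by (simp add: card_image)
  ultimately show "card (range (fp_embed :: 'p mod_ring \<Rightarrow> 'a)) = card {x::'a. x ^ ?p = x}"
    using card_mono[OF _ sub] by simp
qed simp

lemma fp_embed_abs_trace:
  fixes x :: "'a::finite_field"
  assumes "CARD('a) = CARD('p::prime_card) ^ n"
  shows "fp_embed (abs_trace n x :: 'p mod_ring) = (\<Sum>i<n. x ^ (CARD('p) ^ i))"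
proof -
  let ?p = "CARD('p)"
  let ?S = "\<Sum>i<n. x ^ (?p ^ i)"
  note char = CHAR_eq_of_CARD[OF assms]
  have "x ^ (?p ^ n) = x"
    using finite_field_power_card_eq_same[of x] assms by simp
  moreover have "?S ^ ?p = (\<Sum>i<n. x ^ (?p ^ Suc i))"
  proof -
    have "?S ^ ?p = (\<Sum>i<n. (x ^ (?p ^ i)) ^ ?p)"
      by (rule freshmans_dream_sum) (simp_all only: char prime_card)
    also have "\<dots> = (\<Sum>i<n. x ^ (?p ^ Suc i))"
      by (simp only: power_mult [symmetric] power_Suc2)
    finally show ?thesis .
  qed
  moreover have "(\<Sum>i<n. x ^ (?p ^ Suc i)) + x ^ (?p ^ 0) = ?S + x ^ (?p ^ n)"
    using sum.lessThan_Suc_shift[of "\<lambda>i. x ^ (?p ^ i)" n] by simp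
  ultimately have "?S ^ ?p = ?S" by simp
  then have "?S \<in> range (fp_embed :: 'p mod_ring \<Rightarrow> 'a)"
    unfolding range_fp_embed[OF char] by simp
  then obtain t :: "'p mod_ring" where t: "fp_embed t = ?S" by (metis rangeE)
  then show ?thesis
    unfolding abs_trace_def
    by (rule theI) (metis fp_embed_hom(4)[OF char] injD t)
qed

definition trace_orthogonal ::
    "'p::prime_card itself \<Rightarrow> nat \<Rightarrow> 'a::field set \<Rightarrow> 'a set" where
  "trace_orthogonal _ n V = {y. \<forall>v\<in>V. abs_trace n (y * v) = (0 :: 'p mod_ring)}"

definition derivative1 :: "('a::ab_group_add \<Rightarrow> 'b::ab_group_add) \<Rightarrow> 'a \<Rightarrow> 'a \<Rightarrow> 'b" where
  "derivative1 f c x = f (x + c) - f x"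

definition derivative2 :: "('a::ab_group_add \<Rightarrow> 'b::ab_group_add) \<Rightarrow> 'a \<Rightarrow> 'a \<Rightarrow> 'a \<Rightarrow> 'b" where
  "derivative2 f c d x = f (x + c + d) - f (x + c) - f (x + d) + f x"

definition balanced :: "nat \<Rightarrow> ('a::finite \<Rightarrow> 'p::prime_card mod_ring) \<Rightarrow> bool" where
  "balanced n h \<longleftrightarrow> (\<forall>z. card {x. h x = z} = CARD('p) ^ (n - 1))"

definition omega_power :: "'p::prime_card mod_ring \<Rightarrow> complex" where
  "omega_power z = exp (2 * of_real pi * \<i> / of_nat CARD('p)) ^ nat (to_int_mod_ring z)"

definition walsh ::
    "nat \<Rightarrow> ('a::finite_field \<Rightarrow> 'p::prime_card mod_ring) \<Rightarrow> 'a \<Rightarrow> complex" where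
  "walsh n f b = (\<Sum>x\<in>UNIV. omega_power (f x - abs_trace n (b * x)))"

definition bent :: "nat \<Rightarrow> ('a::finite_field \<Rightarrow> 'p::prime_card mod_ring) \<Rightarrow> bool" where
  "bent n f \<longleftrightarrow> (\<forall>b. (cmod (walsh n f b))\<^sup>2 = real CARD('p) ^ n)"

definition regular_bent :: "nat \<Rightarrow> ('a::finite_field \<Rightarrow> 'p::prime_card mod_ring) \<Rightarrow> bool" where
  "regular_bent n f \<longleftrightarrow>
     (\<forall>b. \<exists>z::'p mod_ring.
        of_real (real CARD('p) powr (- (real n / 2))) * walsh n f b = omega_power z)"

text \<open>
  EA-equivalence is defined for functions from any vector space over a field \<open>'k\<close> (given by its
  scalar multiplication \<open>s\<close>) to \<open>'k\<close>.
\<close>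

definition affine_map ::
    "('k::field \<Rightarrow> 'v::ab_group_add \<Rightarrow> 'v) \<Rightarrow> ('k \<Rightarrow> 'w::ab_group_add \<Rightarrow> 'w) \<Rightarrow> ('v \<Rightarrow> 'w) \<Rightarrow> bool" where
  "affine_map s1 s2 h \<longleftrightarrow>
     (\<exists>T c. Vector_Spaces.linear s1 s2 T \<and> (\<forall>x. h x = T x + c))"

definition ea_equivalent ::
    "('k::field \<Rightarrow> 'v::ab_group_add \<Rightarrow> 'v) \<Rightarrow> ('v \<Rightarrow> 'k) \<Rightarrow> ('v \<Rightarrow> 'k) \<Rightarrow> bool" where
  "ea_equivalent s f g \<longleftrightarrow>
     (\<exists>a L l. a \<noteq> 0 \<and> affine_map s s L \<and> bij L \<and> affine_map s (*) l \<and>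
        (\<forall>x. g x = a * f (L x) + l x))"

definition complete_class ::
    "('k::field \<Rightarrow> 'v::ab_group_add \<Rightarrow> 'v) \<Rightarrow> ('v \<Rightarrow> 'k) set \<Rightarrow> bool" where
  "complete_class s C \<longleftrightarrow> (\<exists>E \<subseteq> UNIV // {(f, g). ea_equivalent s f g}. C = \<Union>E)"

definition completed_class ::
    "('k::field \<Rightarrow> 'v::ab_group_add \<Rightarrow> 'v) \<Rightarrow> ('v \<Rightarrow> 'k) set \<Rightarrow> ('v \<Rightarrow> 'k) set" where
  "completed_class s A = \<Inter>{C. complete_class s C \<and> A \<subseteq> C}"

definition dot :: "'k::field ^ 'm \<Rightarrow> 'k ^ 'm \<Rightarrow> 'k" where
  "dot x y = (\<Sum>i\<in>UNIV. x $ i * y $ i)"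

definition maiorana_mcfarland :: "(('k::field ^ 'm) \<times> ('k ^ 'm) \<Rightarrow> 'k) set" where
  "maiorana_mcfarland = {f. \<exists>\<pi> g. bij \<pi> \<and> (\<forall>x y. f (x, y) = dot x (\<pi> y) + g y)}"

abbreviation pair_scale ::
    "'k::field \<Rightarrow> ('k ^ 'm) \<times> ('k ^ 'm) \<Rightarrow> ('k ^ 'm) \<times> ('k ^ 'm)" where
  "pair_scale \<equiv> module_prod.scale (*s) (*s)"

definition in_completed_maiorana_mcfarland ::
    "'m::finite itself \<Rightarrow> ('a::field \<Rightarrow> 'p::prime_card mod_ring) \<Rightarrow> bool" where
  "in_completed_maiorana_mcfarland _ f \<longleftrightarrow>
     (\<exists>\<phi> :: ('p mod_ring ^ 'm) \<times> ('p mod_ring ^ 'm) \<Rightarrow> 'a.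
        Vector_Spaces.linear pair_scale fp_scale \<phi> \<and> bij \<phi> \<and>
        f \<circ> \<phi> \<in> completed_class pair_scale maiorana_mcfarland)"

end

theory Submission
  imports Defs
begin

text \<open>
  Vanishing of the second-order derivatives along \<open>V\<close> means that, for every \<open>w\<close>, the map
  \<open>v \<mapsto> f (w + v) - f w\<close> is a linear functional \<open>\<phi> w\<close> on \<open>V\<close>. Write \<open>W\<close> for the orthogonal of \<open>V\<close>.
  Balancedness of the derivatives makes all nontrivial character sums of \<open>w \<mapsto> \<phi> w\<close> over \<open>W\<close>
  vanish, so \<open>\<phi>\<close> is a bijection from \<open>W\<close> onto the dual of \<open>V\<close>; in coordinates this is the
  permutation of the Maiorana--McFarland form. In the Walsh sum at \<open>b\<close>, summation over the coset
  \<open>w + V\<close> vanishes unless \<open>\<phi> w\<close> equals \<open>v \<mapsto> Tr (b v)\<close>, which holds for exactly one \<open>w \<in> W\<close>.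
\<close>

section \<open>Additive characters of the prime field and their orthogonality\<close>

text \<open>Frees \<open>omega_power\<close> from the representative chosen by
  \<open>to_int_mod_ring\<close>, so that addition in the prime field becomes addition of
  angles.\<close>

lemma omega_power_of_int:
  "omega_power (of_int k :: 'p::prime_card mod_ring) = cis (2 * pi * of_int k / real CARD('p))"
proof -
  let ?p = "CARD('p)"
  have p: "real ?p \<noteq> 0" by simp
  have t: "to_int_mod_ring (of_int k :: 'p mod_ring) = k mod int ?p"
    by transfer simp
  have ratio: "2 * pi * a / c + 2 * pi * b = 2 * pi * (a + b * c) / c" if "c \<noteq> 0" for a b c
    using that by (simp add: field_simps)
  have nn: "real (nat (k mod int ?p)) = of_int (k mod int ?p)"
    by simp
  have "omega_power (of_int k :: 'p mod_ring) = cis (2 * pi / ?p) ^ nat (k mod int ?p)"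
    unfolding omega_power_def t by (simp add: cis_conv_exp mult_ac)
  also have "\<dots> = cis (2 * pi * of_int (k mod int ?p) / ?p)"
    by (simp only: Complex.DeMoivre nn) (simp add: mult_ac)
  \<comment> \<open>The new factor is a whole number of full turns, hence 1; it restores
    \<open>k\<close> from its residue and quotient.\<close>
  also have "\<dots> = cis (2 * pi * of_int (k mod int ?p) / ?p) * cis (2 * pi * of_int (k div int ?p))"
    by simp
  also have "\<dots> = cis (2 * pi * of_int (k mod int ?p) / ?p + 2 * pi * of_int (k div int ?p))"
    by (simp only: cis_mult)
  also have "2 * pi * of_int (k mod int ?p) / ?p + 2 * pi * of_int (k div int ?p)
      = 2 * pi * (real_of_int (k mod int ?p) + real_of_int (k div int ?p) * ?p) / ?p"
    by (rule ratio) (rule p)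
  also have "real_of_int (k mod int ?p) + real_of_int (k div int ?p) * ?p
      = real_of_int (k mod int ?p + k div int ?p * int ?p)"
    by (simp only: of_int_add of_int_mult of_int_of_nat_eq)
  finally show ?thesis by simp
qed

lemma mod_ring_of_int_cases:
  obtains k where "(z :: 'p::prime_card mod_ring) = of_int k"
  by (metis of_int_of_int_mod_ring of_int_mod_ring_to_int_mod_ring)

lemma omega_power_0 [simp]: "omega_power (0 :: 'p::prime_card mod_ring) = 1"
  using omega_power_of_int[of 0, where 'p = 'p] by simp

lemma omega_power_add:
  fixes x y :: "'p::prime_card mod_ring"
  shows "omega_power (x + y) = omega_power x * omega_power y"
proof -
  obtain k l where "x = of_int k" "y = of_int l"
    by (metis mod_ring_of_int_cases)
  then show ?thesis
    using omega_power_of_int[of "k + l", where 'p = 'p]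
    by (simp add: omega_power_of_int cis_mult ring_distribs add_divide_distrib)
qed

lemma norm_omega_power [simp]: "norm (omega_power (x :: 'p::prime_card mod_ring)) = 1"
  by (metis mod_ring_of_int_cases omega_power_of_int norm_cis)

lemma omega_power_neq_1:
  fixes x :: "'p::prime_card mod_ring"
  assumes "x \<noteq> 0"
  shows "omega_power x \<noteq> 1"
proof
  assume 1: "omega_power x = 1"
  obtain k where k: "x = of_int k" by (rule mod_ring_of_int_cases)
  from 1 have "exp (\<i> * of_real (2 * pi * of_int k / real CARD('p))) = 1"
    by (simp add: k omega_power_of_int cis_conv_exp)
  then obtain j :: int where "2 * pi * of_int k / real CARD('p) = of_int (2 * j) * pi"
    unfolding exp_eq_1 by auto
  then have "real_of_int k = of_int (j * int CARD('p))"
    by (simp add: field_simps)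
  then have "k = j * int CARD('p)"
    by (simp only: of_int_eq_iff)
  then have "x = 0" by (simp add: k)
  with assms show False by simp
qed

text \<open>Translation by \<open>v\<close> permutes the finite set \<open>G\<close> and multiplies
  the sum by \<open>omega_power (h v)\<close>, which differs from 1.\<close>

lemma sum_omega_power_additive:
  fixes h :: "'v::ab_group_add \<Rightarrow> 'p::prime_card mod_ring"
  assumes fin: "finite G"
    and closed: "\<And>x y. x \<in> G \<Longrightarrow> y \<in> G \<Longrightarrow> x + y \<in> G"
    and add: "\<And>x y. x \<in> G \<Longrightarrow> y \<in> G \<Longrightarrow> h (x + y) = h x + h y"
    and v: "v \<in> G" "h v \<noteq> 0"
  shows "(\<Sum>x\<in>G. omega_power (h x)) = 0"
proof -
  have "bij_betw (\<lambda>x. x + v) G G"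
    using fin closed v(1) endo_inj_surj[of G "\<lambda>x. x + v"] by (auto simp: bij_betw_def)
  then have "(\<Sum>x\<in>G. omega_power (h x)) = (\<Sum>x\<in>G. omega_power (h (x + v)))"
    by (rule sum.reindex_bij_betw[symmetric])
  also have "\<dots> = (\<Sum>x\<in>G. omega_power (h x)) * omega_power (h v)"
    unfolding sum_distrib_right
    by (rule sum.cong) (simp_all add: add v(1) omega_power_add)
  finally show ?thesis
    using omega_power_neq_1[OF v(2)] by simp
qed

lemma sum_omega_power_UNIV:
  "(\<Sum>z\<in>UNIV. omega_power (z :: 'p::prime_card mod_ring)) = 0"
  by (rule sum_omega_power_additive[where v = 1]) simp_all

text \<open>Grouping by values, all fibres have equal size, so the sum is a multiple of the sum of
  all \<open>p\<close>-th roots of unity.\<close>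

lemma sum_omega_power_balanced:
  fixes h :: "'a::finite \<Rightarrow> 'p::prime_card mod_ring"
  assumes "balanced n h"
  shows "(\<Sum>x\<in>UNIV. omega_power (h x)) = 0"
proof -
  have "(\<Sum>x\<in>UNIV. omega_power (h x))
      = (\<Sum>z\<in>UNIV. of_nat (card {x \<in> UNIV. h x = z}) * omega_power z)"
    by (rule sum_fun_comp) simp_all
  also have "\<dots> = of_nat (CARD('p) ^ (n - 1)) * (\<Sum>z\<in>UNIV. omega_power (z :: 'p mod_ring))"
    using assms by (simp add: balanced_def sum_distrib_left)
  finally show ?thesis
    by (simp add: sum_omega_power_UNIV)
qed

text \<open>Orthogonality of characters: \<open>g - h\<close> is additive, so it either vanishes on
  \<open>G\<close> or gives a nontrivial character.\<close>

lemma sum_omega_power_diff: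
  fixes g h :: "'v::ab_group_add \<Rightarrow> 'p::prime_card mod_ring"
  assumes "finite G"
    and "\<And>x y. x \<in> G \<Longrightarrow> y \<in> G \<Longrightarrow> x + y \<in> G"
    and "\<And>x y. x \<in> G \<Longrightarrow> y \<in> G \<Longrightarrow> g (x + y) = g x + g y"
    and "\<And>x y. x \<in> G \<Longrightarrow> y \<in> G \<Longrightarrow> h (x + y) = h x + h y"
  shows "(\<Sum>x\<in>G. omega_power (g x - h x)) = (if \<forall>x\<in>G. g x = h x then of_nat (card G) else 0)"
proof (cases "\<forall>x\<in>G. g x = h x")
  case False
  then obtain v where v: "v \<in> G" "g v - h v \<noteq> 0" by auto
  show ?thesis
    unfolding if_not_P[OF False]
    by (rule sum_omega_power_additive[where v = v]) (use v assms in simp_all)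
qed simp

text \<open>
  The number of solutions is computed by expanding the indicator of \<open>\<phi> w = a\<close> into characters of
  \<open>V\<close>; only the trivial character contributes.
\<close>

lemma ex1_functional_of_character_sums:
  fixes \<phi> :: "'w \<Rightarrow> 'v::ab_group_add \<Rightarrow> 'p::prime_card mod_ring"
  assumes fin: "finite V" and card_W: "card W = card V"
    and zero: "0 \<in> V"
    and closed: "\<And>x y. x \<in> V \<Longrightarrow> y \<in> V \<Longrightarrow> x + y \<in> V"
    and add: "\<And>w x y. w \<in> W \<Longrightarrow> x \<in> V \<Longrightarrow> y \<in> V \<Longrightarrow> \<phi> w (x + y) = \<phi> w x + \<phi> w y"
    and add_a: "\<And>x y. x \<in> V \<Longrightarrow> y \<in> V \<Longrightarrow> a (x + y) = a x + a y"
    and sum0: "\<And>c. c \<in> V \<Longrightarrow> c \<noteq> 0 \<Longrightarrow> (\<Sum>w\<in>W. omega_power (\<phi> w c)) = 0"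
  shows "\<exists>!w. w \<in> W \<and> (\<forall>v\<in>V. \<phi> w v = a v)"
proof -
  let ?N = "{w \<in> W. \<forall>v\<in>V. \<phi> w v = a v}"
  have V0: "card V > 0"
    using fin zero by (auto simp: card_gt_0_iff)
  then have fin_W: "finite W"
    using card_W by (metis card.infinite less_irrefl)
  have inner: "(\<Sum>c\<in>V. omega_power (\<phi> w c - a c))
      = (if \<forall>v\<in>V. \<phi> w v = a v then of_nat (card V) else 0)" if "w \<in> W" for w
    by (rule sum_omega_power_diff) (simp_all add: fin closed add add_a that)
  have "of_nat (card ?N * card V) = (\<Sum>w\<in>W. \<Sum>c\<in>V. omega_power (\<phi> w c - a c))"
    using fin_W by (simp add: inner sum.If_cases Int_def)
  also have "\<dots> = (\<Sum>c\<in>V. \<Sum>w\<in>W. omega_power (\<phi> w c - a c))"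
    by (rule sum.swap)
  also have "\<dots> = (\<Sum>c\<in>V. (\<Sum>w\<in>W. omega_power (\<phi> w c)) * omega_power (- a c))"
    by (simp add: sum_distrib_right flip: omega_power_add)
  also have "\<dots> = (\<Sum>c\<in>V. if c = 0 then of_nat (card V) else 0)"
  proof (rule sum.cong)
    fix c assume c: "c \<in> V"
    have "\<phi> w 0 = 0" if "w \<in> W" for w
      using add[OF that zero zero] by (simp only: add_0 add_cancel_right_right)
    moreover have "a 0 = 0"
      using add_a[OF zero zero] by (simp only: add_0 add_cancel_right_right)
    ultimately show "(\<Sum>w\<in>W. omega_power (\<phi> w c)) * omega_power (- a c)
        = (if c = 0 then of_nat (card V) else 0)"
      \<comment> \<open>At \<open>c = 0\<close> all \<open>card W\<close> terms equal 1;
        \<open>card_W\<close> makes this the same factor \<open>card V\<close> as on the counting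
        side, so exactly one solution remains.\<close>
      using sum0[OF c] by (auto simp: card_W)
  qed simp
  also have "\<dots> = of_nat (card V)"
    using fin zero by simp
  finally have "card ?N * card V = card V"
    by (simp only: of_nat_eq_iff)
  then have "card ?N = 1"
    using V0 by simp
  then obtain w where "?N = {w}"
    by (auto simp: card_1_singleton_iff)
  then show ?thesis
    by (intro ex1I[of _ w]) auto
qed

section \<open>Cardinality and coordinates of finite subspaces\<close>

text \<open>Each new independent vector \<open>b\<close> multiplies the size by the number of
  scalars, since \<open>k *s b + x\<close> determines both \<open>k\<close> and
  \<open>x \<in> span B\<close>.\<close>

lemma (in vector_space) card_span_independent:
  assumes "finite B" "independent B"
  shows "card (span B) = CARD('a) ^ card B"
  using assms
proof (induction B)
  case empty
  then show ?case by simp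
next
  case (insert b B)
  then have ind: "independent B" and b: "b \<notin> span B"
    by (auto simp: independent_insert)
  have "span (insert b B) = (\<lambda>(k, x). k *s b + x) ` (UNIV \<times> span B)"
  proof (intro equalityI subsetI)
    fix x assume "x \<in> span (insert b B)"
    then obtain k where "x - k *s b \<in> span B"
      by (auto simp: span_breakdown_eq)
    then show "x \<in> (\<lambda>(k, x). k *s b + x) ` (UNIV \<times> span B)"
      by (intro image_eqI[of _ _ "(k, x - k *s b)"]) auto
  next
    fix x assume "x \<in> (\<lambda>(k, x). k *s b + x) ` (UNIV \<times> span B)"
    then obtain k y where "x = k *s b + y" "y \<in> span B"
      by auto
    then show "x \<in> span (insert b B)"
      unfolding span_breakdown_eq by (intro exI[of _ k]) simp
  qed
  moreover have "inj_on (\<lambda>(k, x). k *s b + x) (UNIV \<times> span B)"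
  proof (rule inj_onI, clarify)
    fix k l x y
    assume xy: "x \<in> span B" "y \<in> span B" and eq: "k *s b + x = l *s b + y"
    then have "(k - l) *s b = y - x"
      by (simp add: scale_left_diff_distrib algebra_simps)
    with xy have "(k - l) *s b \<in> span B"
      by (simp add: span_diff)
    \<comment> \<open>For \<open>k \<noteq> l\<close> this element is \<open>b\<close> itself,
      contradicting independence.\<close>
    then have "inverse (k - l) *s ((k - l) *s b) \<in> span B"
      by (rule span_scale)
    with b have "k = l"
      by (cases "k = l") simp_all
    with eq show "k = l \<and> x = y" by simp
  qed
  ultimately show ?case
    using insert ind by (simp add: card_image card_cartesian_product)
qed

lemma (in vector_space) card_subspace:
  assumes "finite U" "subspace U"
  shows "card U = CARD('a) ^ dim U"
proof -
  obtain B where B: "B \<subseteq> U" "independent B" "U \<subseteq> span B" "card B = dim U"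
    by (rule basis_exists)
  then have "span B = U"
    using assms(2) by (simp add: span_subspace)
  with B card_span_independent[of B] assms(1) show ?thesis
    by (simp add: finite_subset)
qed

text \<open>A basis is indexed by the type \<open>'m\<close> to match the vectors of the
  Maiorana--McFarland form. Spanning gives surjectivity; equal cardinalities then give
  injectivity.\<close>

lemma subspace_coordinates:
  fixes s :: "'k::{field, finite} \<Rightarrow> 'b::ab_group_add \<Rightarrow> 'b"
  assumes vs: "vector_space s" and sub: "module.subspace s U" and fin: "finite U"
    and dim: "vector_space.dim s U = CARD('m::finite)"
  obtains b :: "'m::finite \<Rightarrow> 'b" where "range b \<subseteq> U"
    and "bij_betw (\<lambda>x :: 'k ^ 'm. \<Sum>i\<in>UNIV. s (x $ i) (b i)) UNIV U"
proof -
  interpret vector_space s by (rule vs)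
  obtain B where B: "B \<subseteq> U" "independent B" "U \<subseteq> span B" "card B = dim U"
    by (rule basis_exists)
  have span_B: "span B = U"
    using B sub by (simp add: span_subspace)
  have fin_B: "finite B"
    using B(1) fin by (rule finite_subset)
  then obtain b where b: "bij_betw b (UNIV :: 'm set) B"
    using B(4) dim finite_same_card_bij[of "UNIV :: 'm set" B] by auto
  let ?L = "\<lambda>x :: 'k ^ 'm. \<Sum>i\<in>UNIV. s (x $ i) (b i)"
  have range: "range ?L = U"
  proof (intro equalityI subsetI)
    fix x assume "x \<in> range ?L"
    then show "x \<in> U"
      using b B(1) sub
      by (auto simp: bij_betw_def intro!: subspace_sum subspace_scale)
  next
    fix x assume "x \<in> U"
    then obtain u where "x = (\<Sum>v\<in>B. s (u v) v)"
      unfolding span_B[symmetric] span_finite[OF fin_B] by auto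
    also have "\<dots> = (\<Sum>i\<in>UNIV. s (u (b i)) (b i))"
      using b by (rule sum.reindex_bij_betw[symmetric])
    finally show "x \<in> range ?L"
      by (intro image_eqI[of _ _ "\<chi> i. u (b i)"]) simp_all
  qed
  have "card (range ?L) = card (UNIV :: ('k ^ 'm) set)"
    unfolding range using card_subspace[OF fin sub] dim by simp
  then have "inj ?L"
    by (rule eq_card_imp_inj_on[OF finite])
  with range have "bij_betw ?L UNIV U"
    by (simp add: bij_betw_def)
  moreover have "range b \<subseteq> U"
    using b B(1) by (simp add: bij_betw_def)
  ultimately show thesis by (rule that[rotated])
qed

section \<open>Linearity over the prime field, and the trace\<close>

text \<open>Every scalar of the prime field is a multiple of 1, so scaling is repeated
  addition.\<close>

lemma additive_imp_fp_scale:
  fixes h :: "'a::field \<Rightarrow> 'p::prime_card mod_ring"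
  assumes char: "CHAR('a) = CARD('p)"
    and sub: "module.subspace (fp_scale :: 'p mod_ring \<Rightarrow> 'a \<Rightarrow> 'a) U"
    and add: "\<And>x y. x \<in> U \<Longrightarrow> y \<in> U \<Longrightarrow> h (x + y) = h x + h y"
    and x: "x \<in> U"
  shows "h (fp_scale c x) = c * h x"
proof -
  interpret vector_space "fp_scale :: 'p mod_ring \<Rightarrow> 'a \<Rightarrow> 'a"
    by (rule vector_space_fp_scale[OF char])
  have h0: "h 0 = 0"
    using add[OF subspace_0[OF sub] subspace_0[OF sub]] by (simp only: add_0 add_cancel_right_right)
  have nat: "h (fp_scale (of_nat k :: 'p mod_ring) x) = of_nat k * h x" for k
    by (induction k) (simp_all add: h0 x add scale_left_distrib ring_distribs sub subspace_scale)
  have "c = of_nat (nat (to_int_mod_ring c))"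
    by (metis of_int_of_int_mod_ring of_int_mod_ring_to_int_mod_ring of_nat_nat
        of_int_of_nat_eq atLeastLessThan_iff range_to_int_mod_ring rangeI)
  then show ?thesis
    using nat by metis
qed

lemma additive_imp_sum_fp_scale:
  fixes h :: "'a::field \<Rightarrow> 'p::prime_card mod_ring"
  assumes char: "CHAR('a) = CARD('p)"
    and sub: "module.subspace (fp_scale :: 'p mod_ring \<Rightarrow> 'a \<Rightarrow> 'a) U"
    and add: "\<And>x y. x \<in> U \<Longrightarrow> y \<in> U \<Longrightarrow> h (x + y) = h x + h y"
    and b: "\<And>i. i \<in> I \<Longrightarrow> b i \<in> U"
  shows "h (\<Sum>i\<in>I. fp_scale (c i) (b i)) = (\<Sum>i\<in>I. c i * h (b i))"
proof -
  interpret vector_space "fp_scale :: 'p mod_ring \<Rightarrow> 'a \<Rightarrow> 'a"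
    by (rule vector_space_fp_scale[OF char])
  have h0: "h 0 = 0"
    using add[OF subspace_0[OF sub] subspace_0[OF sub]] by (simp only: add_0 add_cancel_right_right)
  show ?thesis
    using b
    by (induction I rule: infinite_finite_induct)
      (simp_all add: h0 add sub subspace_sum subspace_scale additive_imp_fp_scale[OF char sub add])
qed

text \<open>Powers of Frobenius are additive; the identity is checked in the large field and pulled
  back along the injective \<open>fp_embed\<close>.\<close>

lemma abs_trace_add:
  fixes x y :: "'a::finite_field"
  assumes card: "CARD('a) = CARD('p::prime_card) ^ n"
  shows "(abs_trace n (x + y) :: 'p mod_ring) = abs_trace n x + abs_trace n y"
proof -
  note char = CHAR_eq_of_CARD[OF card]
  have "(x + y) ^ (CARD('p) ^ i) = x ^ (CARD('p) ^ i) + y ^ (CARD('p) ^ i)" for i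
    by (rule freshmans_dream') (simp_all only: char prime_card)
  then have "fp_embed (abs_trace n (x + y) :: 'p mod_ring)
      = (fp_embed (abs_trace n x + abs_trace n y :: 'p mod_ring) :: 'a)"
    by (simp add: fp_embed_hom(1)[OF char] fp_embed_abs_trace[OF card] sum.distrib)
  then show ?thesis
    using fp_embed_hom(4)[OF char] by (simp add: inj_eq)
qed

lemma subspace_trace_orthogonal:
  assumes card: "CARD('a::finite_field) = CARD('p::prime_card) ^ n"
  shows "module.subspace (fp_scale :: 'p mod_ring \<Rightarrow> 'a \<Rightarrow> 'a) (trace_orthogonal TYPE('p) n V)"
proof -
  note char = CHAR_eq_of_CARD[OF card]
  interpret vector_space "fp_scale :: 'p mod_ring \<Rightarrow> 'a \<Rightarrow> 'a"
    by (rule vector_space_fp_scale[OF char])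
  note add = abs_trace_add[OF card]
  have zero: "abs_trace n (0 :: 'a) = (0 :: 'p mod_ring)"
    using add[of 0 0] by (simp only: add_0 add_cancel_right_right)
  have scale: "abs_trace n (fp_scale c x * v) = c * (abs_trace n (x * v) :: 'p mod_ring)"
    for c :: "'p mod_ring" and x v :: 'a
    by (rule additive_imp_fp_scale[OF char subspace_UNIV]) (simp_all add: add ring_distribs)
  show ?thesis
    by (rule subspaceI) (auto simp: trace_orthogonal_def zero add scale ring_distribs)
qed

lemma subset_completed_class: "A \<subseteq> completed_class s A"
  by (auto simp: completed_class_def)

theorem theorem1:
  fixes f :: "'a::finite_field \<Rightarrow> 'p::prime_card mod_ring"
    and V :: "'a set"
    and n :: nat
  assumes card_field: "CARD('a) = CARD('p) ^ n"
    and even_n: "even n"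
    and card_index: "CARD('m::finite) = n div 2"
    and subspace_V: "module.subspace (fp_scale :: 'p mod_ring \<Rightarrow> 'a \<Rightarrow> 'a) V"
    and dim_V: "vector_space.dim (fp_scale :: 'p mod_ring \<Rightarrow> 'a \<Rightarrow> 'a) V = n div 2"
    and inter: "V \<inter> trace_orthogonal TYPE('p) n V = {0}"
    and sum: "\<forall>x. \<exists>v\<in>V. \<exists>w\<in>trace_orthogonal TYPE('p) n V. x = v + w"
    and second: "\<forall>c\<in>V. \<forall>d\<in>V. \<forall>x. derivative2 f c d x = 0"
    and first: "\<forall>c\<in>V - {0}. balanced n (derivative1 f c)"
  shows "bent n f \<and> regular_bent n f \<and> in_completed_maiorana_mcfarland TYPE('m) f"
proof -
  let ?m = "n div 2"
  define W :: "'a set" where "W = trace_orthogonal TYPE('p) n V"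
  define \<phi> where "\<phi> w v = f (w + v) - f w" for w v
  note char = CHAR_eq_of_CARD[OF card_field]
  interpret vector_space "fp_scale :: 'p mod_ring \<Rightarrow> 'a \<Rightarrow> 'a"
    by (rule vector_space_fp_scale[OF char])
  have subspace_W: "subspace W"
    unfolding W_def by (rule subspace_trace_orthogonal[OF card_field])
  have q: "CARD('p) > 1"
    using prime_card[where 'a = 'p] prime_gt_1_nat by simp
  have n: "n = ?m + ?m"
    using even_n by (metis dvd_mult_div_cancel mult_2)
  have card_V: "card V = CARD('p) ^ ?m"
    using card_subspace[OF _ subspace_V] dim_V by simp

  \<comment> \<open>Decomposition of the field into cosets of \<open>V\<close>\<close>
  have decomp: "bij_betw (\<lambda>(w, v). w + v) (W \<times> V) UNIV"
  proof (unfold bij_betw_def, intro conjI)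
    show "inj_on (\<lambda>(w, v). w + v) (W \<times> V)"
    proof (rule inj_onI, clarify)
      fix w w' v v'
      assume "w \<in> W" "w' \<in> W" "v \<in> V" "v' \<in> V" and eq: "w + v = w' + v'"
      then have "v - v' \<in> V" "w' - w \<in> W"
        using subspace_V subspace_W by (auto intro: subspace_diff)
      moreover have "v - v' = w' - w"
        using eq by (simp add: algebra_simps)
      ultimately have "v - v' \<in> V \<inter> W" by simp
      then have "v - v' = 0"
        using inter unfolding W_def by blast
      with eq show "w = w' \<and> v = v'" by simp
    qed
    show "(\<lambda>(w, v). w + v) ` (W \<times> V) = UNIV"
    proof (intro equalityI subsetI UNIV_I)
      fix x
      obtain v w where "v \<in> V" "w \<in> W" "x = v + w"
        using sum unfolding W_def by blast
      then show "x \<in> (\<lambda>(w, v). w + v) ` (W \<times> V)"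
        by (intro image_eqI[of _ _ "(w, v)"]) (simp_all add: add.commute)
    qed
  qed
  have sum_decomp: "(\<Sum>x\<in>UNIV. F x) = (\<Sum>w\<in>W. \<Sum>v\<in>V. F (w + v))" for F :: "'a \<Rightarrow> complex"
    by (simp add: sum.cartesian_product case_prod_unfold
        flip: sum.reindex_bij_betw[OF decomp])
  \<comment> \<open>The size of \<open>W\<close> comes from counting the decomposition, without
    appeal to nondegeneracy of the trace form.\<close>
  have "card W * card V = CARD('p) ^ ?m * CARD('p) ^ ?m"
    using bij_betw_same_card[OF decomp] n
    by (simp add: card_cartesian_product card_field flip: power_add)
  then have card_W: "card W = card V"
    using q by (simp add: card_V)
  then have dim_W: "dim W = ?m"
    using card_subspace[OF _ subspace_W] q by (simp add: card_V power_inject_exp)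

  \<comment> \<open>The functionals given by derivatives along \<open>V\<close>\<close>
  have \<phi>_add: "\<phi> w (c + d) = \<phi> w c + \<phi> w d" if "c \<in> V" "d \<in> V" for w c d
    using second that by (simp add: derivative2_def \<phi>_def algebra_simps)
  \<comment> \<open>Derivatives in directions of \<open>V\<close> are constant on cosets of
    \<open>V\<close>, so character sums over the field collapse to sums over
    \<open>W\<close>.\<close>
  have shift: "derivative1 f c (w + v) = \<phi> w c" if "c \<in> V" "v \<in> V" for w c v
    using second that by (simp add: derivative1_def derivative2_def \<phi>_def algebra_simps)
  have sum0: "(\<Sum>w\<in>W. omega_power (\<phi> w c)) = 0" if c: "c \<in> V" "c \<noteq> 0" for c
  proof -
    have "0 = (\<Sum>x\<in>UNIV. omega_power (derivative1 f c x))"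
      using first c by (intro sum_omega_power_balanced[symmetric]) auto
    also have "\<dots> = (\<Sum>w\<in>W. \<Sum>v\<in>V. omega_power (derivative1 f c (w + v)))"
      by (rule sum_decomp)
    also have "\<dots> = of_nat (card V) * (\<Sum>w\<in>W. omega_power (\<phi> w c))"
      by (simp add: shift c sum_distrib_left)
    finally show ?thesis
      using q by (simp add: card_V)
  qed
  \<comment> \<open>Thus \<open>\<phi>\<close> maps \<open>W\<close> bijectively onto the dual of
    \<open>V\<close>. This yields both the single surviving coset in the Walsh sum and the
    injectivity of \<open>\<pi>\<close>.\<close>
  have ex1: "\<exists>!w. w \<in> W \<and> (\<forall>v\<in>V. \<phi> w v = a v)"
    if "\<And>x y. x \<in> V \<Longrightarrow> y \<in> V \<Longrightarrow> a (x + y) = a x + a y" for a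
    by (rule ex1_functional_of_character_sums)
      (use subspace_V in \<open>simp_all add: card_W that \<phi>_add sum0 subspace_0 subspace_add\<close>)

  \<comment> \<open>Walsh transform and regular bentness\<close>
  have walsh: "\<exists>z::'p mod_ring. walsh n f b = of_nat (CARD('p) ^ ?m) * omega_power z" for b
  proof -
    let ?T = "\<lambda>x. abs_trace n (b * x) :: 'p mod_ring"
    have T_add: "?T (x + y) = ?T x + ?T y" for x y
      by (simp add: abs_trace_add[OF card_field] ring_distribs)
    obtain u where u: "\<And>w. w \<in> W \<Longrightarrow> (\<forall>v\<in>V. \<phi> w v = ?T v) \<longleftrightarrow> w = u" "u \<in> W"
      using ex1[of ?T, OF T_add] by blast
    \<comment> \<open>The exponent splits into a part constant on the coset and a part additive in
      \<open>v \<in> V\<close>.\<close>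
    have "f (w + v) - ?T (w + v) = (f w - ?T w) + (\<phi> w v - ?T v)" for w v
      by (simp add: \<phi>_def T_add)
    then have "walsh n f b
        = (\<Sum>w\<in>W. omega_power (f w - ?T w) * (\<Sum>v\<in>V. omega_power (\<phi> w v - ?T v)))"
      unfolding walsh_def sum_decomp by (simp add: omega_power_add sum_distrib_left)
    also have "\<dots> = (\<Sum>w\<in>W. if w = u then omega_power (f w - ?T w) * of_nat (card V) else 0)"
    proof (rule sum.cong)
      fix w assume w: "w \<in> W"
      have "(\<Sum>v\<in>V. omega_power (\<phi> w v - ?T v)) = (if w = u then of_nat (card V) else 0)"
        unfolding u(1)[OF w, symmetric]
        by (rule sum_omega_power_diff)
          (use subspace_V in \<open>simp_all add: \<phi>_add T_add subspace_add\<close>)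
      then show "omega_power (f w - ?T w) * (\<Sum>v\<in>V. omega_power (\<phi> w v - ?T v))
          = (if w = u then omega_power (f w - ?T w) * of_nat (card V) else 0)"
        by simp
    qed simp
    also have "\<dots> = of_nat (CARD('p) ^ ?m) * omega_power (f u - ?T u)"
      using u(2) by (simp add: card_V mult.commute)
    finally show ?thesis by blast
  qed

  have "bent n f"
    unfolding bent_def
  proof
    fix b
    obtain z :: "'p mod_ring" where "walsh n f b = of_nat (CARD('p) ^ ?m) * omega_power z"
      using walsh by blast
    then have "cmod (walsh n f b) = real CARD('p) ^ ?m"
      by (simp add: norm_mult norm_power)
    then show "(cmod (walsh n f b))\<^sup>2 = real CARD('p) ^ n"
      by (subst n) (simp add: power2_eq_square power_add)
  qed
  moreover have "regular_bent n f"
    unfolding regular_bent_def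
  proof
    fix b
    obtain z :: "'p mod_ring" where z: "walsh n f b = of_nat (CARD('p) ^ ?m) * omega_power z"
      using walsh by blast
    \<comment> \<open>Evenness identifies the real quotient with \<open>n div 2\<close>, so the
      normalising factor exactly cancels the modulus of the Walsh value.\<close>
    have "real n / 2 = real ?m"
      using even_n by (simp add: real_of_nat_div)
    then have "real CARD('p) powr (- (real n / 2)) * real CARD('p) ^ ?m = 1"
      using q by (simp add: powr_minus powr_realpow)
    then have "of_real (real CARD('p) powr (- (real n / 2))) * (of_nat (CARD('p) ^ ?m) :: complex) = 1"
      by (metis of_nat_power of_real_1 of_real_mult of_real_of_nat_eq)
    then show "\<exists>z::'p mod_ring.
        of_real (real CARD('p) powr (- (real n / 2))) * walsh n f b = omega_power z"
      unfolding z by (metis mult.assoc mult_1)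
  qed

  \<comment> \<open>Coordinates giving the Maiorana--McFarland form\<close>
  moreover have "in_completed_maiorana_mcfarland TYPE('m) f"
  proof -
    obtain e :: "'m \<Rightarrow> 'a" where e: "range e \<subseteq> V"
      and bij_e: "bij_betw (\<lambda>x :: 'p mod_ring ^ 'm. \<Sum>i\<in>UNIV. fp_scale (x $ i) (e i)) UNIV V"
      by (rule subspace_coordinates[where 'm = 'm, OF vector_space_axioms subspace_V])
        (use dim_V card_index in simp_all)
    obtain e' :: "'m \<Rightarrow> 'a" where
      bij_e': "bij_betw (\<lambda>x :: 'p mod_ring ^ 'm. \<Sum>i\<in>UNIV. fp_scale (x $ i) (e' i)) UNIV W"
      by (rule subspace_coordinates[where 'm = 'm, OF vector_space_axioms subspace_W])
        (use dim_W card_index in simp_all)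
    define X where "X = (\<lambda>x :: 'p mod_ring ^ 'm. \<Sum>i\<in>UNIV. fp_scale (x $ i) (e i))"
    define Y where "Y = (\<lambda>y :: 'p mod_ring ^ 'm. \<Sum>i\<in>UNIV. fp_scale (y $ i) (e' i))"
    have bij_X: "bij_betw X UNIV V" and bij_Y: "bij_betw Y UNIV W"
      using bij_e bij_e' by (simp_all add: X_def Y_def)
    \<comment> \<open>The first argument parametrises \<open>V\<close>, along which \<open>f\<close>
      is affine; the second selects the coset.\<close>
    define \<theta> where "\<theta> = (\<lambda>(x, y). Y y + X x)"
    \<comment> \<open>The coordinates of the functional \<open>\<phi> (Y y)\<close> in the basis
      dual to \<open>e\<close>.\<close>
    define \<pi> where "\<pi> y = (\<chi> i. \<phi> (Y y) (e i))" for y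
    have \<phi>_X: "\<phi> w (X x) = dot x (\<chi> i. \<phi> w (e i))" for w x
      unfolding X_def dot_def
      using e by (subst additive_imp_sum_fp_scale[OF char subspace_V]) (auto simp: \<phi>_add)

    have "bij \<theta>"
    proof -
      have "bij_betw (map_prod Y X) (UNIV \<times> UNIV) (W \<times> V)"
        using bij_Y bij_X by (rule bij_betw_map_prod)
      \<comment> \<open>The swap is due to \<open>decomp\<close> taking the \<open>W\<close>
        component first, while \<open>\<theta>\<close> takes the \<open>V\<close> coordinates
        first.\<close>
      then have "bij_betw ((\<lambda>(w, v). w + v) \<circ> map_prod Y X \<circ> prod.swap) UNIV UNIV"
        using decomp by (auto intro!: bij_betw_trans)
      moreover have "(\<lambda>(w, v). w + v) \<circ> map_prod Y X \<circ> prod.swap = \<theta>"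
        by (auto simp: \<theta>_def)
      ultimately show ?thesis by simp
    qed
    moreover have "Vector_Spaces.linear pair_scale fp_scale \<theta>"
    proof -
      interpret prod: vector_space_prod "(*s) :: 'p mod_ring \<Rightarrow> _ \<Rightarrow> 'p mod_ring ^ 'm"
          "(*s) :: 'p mod_ring \<Rightarrow> _ \<Rightarrow> 'p mod_ring ^ 'm"
        by unfold_locales
      show ?thesis
        by unfold_locales
          (auto simp: \<theta>_def X_def Y_def prod.scale_def scale_left_distrib scale_right_distrib
            sum.distrib scale_sum_right)
    qed
    moreover have "f \<circ> \<theta> \<in> maiorana_mcfarland"
    proof -
      have "inj \<pi>"
      proof (rule injI)
        fix y y' assume "\<pi> y = \<pi> y'"
        then have "\<phi> (Y y) (X x) = \<phi> (Y y') (X x)" for x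
          by (simp add: \<phi>_X \<pi>_def)
        then have "\<forall>v\<in>V. \<phi> (Y y) v = \<phi> (Y y') v"
          using bij_X by (auto simp: bij_betw_def)
        moreover have "Y y \<in> W" "Y y' \<in> W"
          using bij_Y by (auto simp: bij_betw_def)
        ultimately have "Y y = Y y'"
          using ex1[of "\<phi> (Y y')"] \<phi>_add by blast
        then show "y = y'"
          using bij_Y by (auto simp: bij_betw_def inj_eq)
      qed
      then have "bij \<pi>"
        by (simp add: bij_def finite_UNIV_inj_surj)
      \<comment> \<open>By definition of \<open>\<phi>\<close>, \<open>f (Y y + X x)\<close> is
        \<open>f (Y y)\<close> plus \<open>\<phi> (Y y) (X x)\<close>; the arbitrary summand
        \<open>g\<close> is \<open>f\<close> on the representatives in \<open>W\<close>.\<close>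
      moreover have "(f \<circ> \<theta>) (x, y) = dot x (\<pi> y) + f (Y y)" for x y
        using \<phi>_X[of "Y y" x] by (simp add: \<theta>_def \<pi>_def \<phi>_def algebra_simps)
      ultimately show ?thesis
        unfolding maiorana_mcfarland_def
        by (intro CollectI exI[of _ \<pi>] exI[of _ "\<lambda>y. f (Y y)"] conjI allI)
    qed
    \<comment> \<open>Since \<open>f \<circ> \<theta>\<close> already lies in the class itself,
      inclusion in the completed class suffices.\<close>
    ultimately show ?thesis
      unfolding in_completed_maiorana_mcfarland_def
      using subset_completed_class by blast
  qed
  ultimately show ?thesis by simp
qed

end
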